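(* Let $\theta>0$ and let $(a_n)_{n\ge 1}$, $(b_n)_{n\ge 1}$ be sequences in $(0,\infty)$. Put $\pi_1=1$ and $\pi_j=\frac{a_1}{a_1+b_1}\cdots\frac{a_{j-1}}{a_{j-1}+b_{j-1}}$ for $j\ge 2$, and assume (i) $a_j+b_j-a_{j+1}>0$ for each $j\ge 1$; (ii) $\sum_{j=1}^\infty \pi_{j+1}\,(a_j+b_j-a_{j+1})<\infty$; (iii) $\pi_j a_j\to 0$ as $j\to\infty$. Fix a constant $c_1>0$ and let $c_j=a_{j-1}+b_{j-1}-a_j$ for $j\ge 2$. Suppose that $G_n\sim \mathrm{gamma}(c_n,\theta)$ and $U_n\sim\mathrm{beta}(a_n,b_n)$, $n\ge 1$, are all independent random variables, and let $\Pi_j=\prod_{l=1}^{j-1}U_l$ for $j\ge 1$ (so $\Pi_1=1$). Then the random series $\sum_{j=1}^\infty G_j\Pi_j$ converges almost surely. Moreover, the random variables $$\tilde V_n=\frac{G_n\Pi_n}{\sum_{j=1}^\infty G_j\Pi_j},\qquad n=1,2,\ldots,$$ have the representation $$\tilde V_1=\tilde Y_1,\qquad \tilde V_n=(1-\tilde Y_1)\cdots(1-\tilde Y_{n-1})\tilde Y_n,\quad n\ge 2,$$ with independent random variables $\tilde Y_n\sim\mathrm{beta}(c_n,a_n)$, $n\ge1$.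
   Context: $\mathrm{gamma}(c,\theta)$ denotes the gamma distribution with shape $c>0$ and rate $\theta>0$, with density proportional to $x^{c-1}e^{-\theta x}$ on $(0,\infty)$. $\mathrm{beta}(a,b)$ denotes the distribution with density proportional to $x^{a-1}(1-x)^{b-1}$ on $(0,1)$. *)

theory Defs
  imports "HOL-Probability.Probability"
begin

text \<open>
  Shape \<open>c\<close>, rate \<open>\<theta>\<close>. The normalising constants below and in \<open>beta_density\<close> are the ones that
  make the densities integrate to one; see \<open>prob_space_gamma_density\<close> and
  \<open>prob_space_beta_density\<close>.
\<close>

definition gamma_density :: "real \<Rightarrow> real \<Rightarrow> real \<Rightarrow> real" where
  "gamma_density c \<theta> x =
     (if 0 < x then \<theta> powr c / Gamma c * x powr (c - 1) * exp (- \<theta> * x) else 0)"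

definition beta_density :: "real \<Rightarrow> real \<Rightarrow> real \<Rightarrow> real" where
  "beta_density a b x =
     (if 0 < x \<and> x < 1 then x powr (a - 1) * (1 - x) powr (b - 1) / Beta a b else 0)"

lemma borel_measurable_gamma_density [measurable]: "gamma_density c \<theta> \<in> borel_measurable borel"
  unfolding gamma_density_def[abs_def] by measurable

lemma borel_measurable_beta_density [measurable]: "beta_density a b \<in> borel_measurable borel"
  unfolding beta_density_def[abs_def] by measurable

lemma gamma_density_nonneg: "0 < c \<Longrightarrow> 0 \<le> gamma_density c \<theta> x"
  by (simp add: gamma_density_def Gamma_real_pos less_imp_le)

lemma beta_density_nonneg: "0 < a \<Longrightarrow> 0 < b \<Longrightarrow> 0 \<le> beta_density a b x"
  by (simp add: beta_density_def Beta_def Gamma_real_pos less_imp_le)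

lemma prob_space_gamma_density:
  assumes "0 < c" "0 < \<theta>"
  shows "prob_space (density lborel (gamma_density c \<theta>))"
proof -
  define f :: "real \<Rightarrow> real" where "f t = indicator {0..} t * t powr (c - 1) / exp t" for t
  have [measurable]: "f \<in> borel_measurable borel"
    unfolding f_def[abs_def] by measurable
  have Gamma_pos: "0 < Gamma c"
    using assms by (simp add: Gamma_real_pos)
  have density_eq: "gamma_density c \<theta> x = \<theta> / Gamma c * f (\<theta> * x)" for x
  proof (cases "0 < x")
    case True
    have "\<theta> powr c = \<theta> * \<theta> powr (c - 1)"
      using assms by (simp add: powr_mult_base)
    with True assms show ?thesis
      by (simp add: gamma_density_def f_def powr_mult exp_minus field_simps)
  next
    case False
    then have "f (\<theta> * x) = 0"
      using assms by (cases "x = 0") (auto simp: f_def zero_le_mult_iff)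
    with False show ?thesis
      by (simp add: gamma_density_def)
  qed
  have f_nonneg: "0 \<le> f t" for t
    by (simp add: f_def)
  have "ennreal (Gamma c) = (\<integral>\<^sup>+t. ennreal (f t) \<partial>lborel)"
    unfolding f_def using assms by (simp add: Gamma_conv_nn_integral_real)
  also have "\<dots> = ennreal \<theta> * (\<integral>\<^sup>+x. ennreal (f (\<theta> * x)) \<partial>lborel)"
    using assms nn_integral_real_affine[of "\<lambda>t. ennreal (f t)" \<theta> 0] by simp
  finally have *: "ennreal \<theta> * (\<integral>\<^sup>+x. ennreal (f (\<theta> * x)) \<partial>lborel) = ennreal (Gamma c)" ..
  have "(\<integral>\<^sup>+x. ennreal (gamma_density c \<theta> x) \<partial>lborel) =
        (\<integral>\<^sup>+x. ennreal (1 / Gamma c) * (ennreal \<theta> * ennreal (f (\<theta> * x))) \<partial>lborel)"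
    using assms Gamma_pos f_nonneg
    by (intro nn_integral_cong) (simp add: density_eq ennreal_mult[symmetric])
  also have "\<dots> = ennreal (1 / Gamma c) * ennreal (Gamma c)"
    by (simp add: nn_integral_cmult *)
  also have "\<dots> = 1"
    using Gamma_pos by (simp add: ennreal_mult[symmetric])
  finally show ?thesis
    by (intro prob_spaceI) (simp add: emeasure_density)
qed

lemma prob_space_beta_density:
  assumes "0 < a" "0 < b"
  shows "prob_space (density lborel (beta_density a b))"
proof -
  have Beta_pos: "0 < Beta a b"
    using assms by (simp add: Beta_def Gamma_real_pos)
  have "((\<lambda>t. t powr (a - 1) * (1 - t) powr (b - 1) / Beta a b) has_integral 1) {0..1}"
    using has_integral_divide[OF has_integral_Beta_real[OF assms], of "Beta a b"] Beta_pos by simp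
  then have "(\<integral>\<^sup>+t. ennreal (indicator {0..1} t * (t powr (a - 1) * (1 - t) powr (b - 1) / Beta a b))
       \<partial>lborel) = ennreal 1"
    using Beta_pos by (intro nn_integral_has_integral_lebesgue) auto
  moreover have "beta_density a b t =
      indicator {0..1} t * (t powr (a - 1) * (1 - t) powr (b - 1) / Beta a b)" for t
    by (cases "t = 0 \<or> t = 1") (auto simp: beta_density_def indicator_def)
  ultimately show ?thesis
    by (intro prob_spaceI) (simp add: emeasure_density)
qed

end

theory Submission
  imports Defs
begin

text \<open>
  Let \<open>R\<^sub>n = G\<^sub>n + U\<^sub>n G\<^sub>n\<^sub>+\<^sub>1 + U\<^sub>n U\<^sub>n\<^sub>+\<^sub>1 G\<^sub>n\<^sub>+\<^sub>2 + \<dots>\<close> be the tails of the series, so that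
  \<open>R\<^sub>n = G\<^sub>n + U\<^sub>n R\<^sub>n\<^sub>+\<^sub>1\<close> with \<open>G\<^sub>n\<close>, \<open>U\<^sub>n\<close>, \<open>R\<^sub>n\<^sub>+\<^sub>1\<close> independent. The series converges almost surely because the
  expectation of its sum, \<open>\<Sum>\<^sub>j \<pi>\<^sub>j c\<^sub>j / \<theta>\<close> with \<open>\<pi>\<^sub>j = E \<Pi>\<^sub>j\<close>, is finite. The ratios are \<open>Y\<^sub>n = G\<^sub>n / R\<^sub>n\<close>: since
  \<open>1 - Y\<^sub>n = U\<^sub>n R\<^sub>n\<^sub>+\<^sub>1 / R\<^sub>n\<close>, the products telescope to
  \<open>(1 - Y\<^sub>1) \<dots> (1 - Y\<^sub>n\<^sub>-\<^sub>1) = \<Pi>\<^sub>n R\<^sub>n / R\<^sub>1\<close>, which is the claimed representation.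

  If \<open>R\<^sub>n\<^sub>+\<^sub>1\<close> has law \<open>gamma(a\<^sub>n + b\<^sub>n, \<theta>)\<close>, then by the beta-gamma algebra \<open>U\<^sub>n R\<^sub>n\<^sub>+\<^sub>1\<close> has law
  \<open>gamma(a\<^sub>n, \<theta>)\<close>, and so \<open>R\<^sub>n\<close> and \<open>Y\<^sub>n\<close> are independent with laws \<open>gamma(c\<^sub>n + a\<^sub>n, \<theta>)\<close> and
  \<open>beta(c\<^sub>n, a\<^sub>n)\<close>; moreover \<open>c\<^sub>n + a\<^sub>n = a\<^sub>n\<^sub>-\<^sub>1 + b\<^sub>n\<^sub>-\<^sub>1\<close> for \<open>n \<ge> 2\<close>. The laws \<open>gamma(c\<^sub>n + a\<^sub>n, \<theta>)\<close> thus satisfy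
  the same recursion in distribution as the laws of the tails. That the two agree (\<open>law_R\<close>) follows by
  comparing characteristic functions, \<open>\<phi>\<^sub>n\<close> of \<open>R\<^sub>n\<close> and \<open>\<psi>\<^sub>n\<close> of the gamma law. If
  \<open>\<bar>\<phi>\<^sub>n\<^sub>+\<^sub>1(s) - \<psi>\<^sub>n\<^sub>+\<^sub>1(s)\<bar> \<le> K \<bar>s\<bar>\<close> for all \<open>s\<close>, then the same holds at \<open>n\<close> with
  \<open>K E U\<^sub>n = K \<pi>\<^sub>n\<^sub>+\<^sub>1 / \<pi>\<^sub>n\<close>, while trivially the bound holds at \<open>m\<close> with \<open>K = E R\<^sub>m + (c\<^sub>m + a\<^sub>m) / \<theta>\<close>. Hence
  \<open>\<pi>\<^sub>n \<bar>\<phi>\<^sub>n(s) - \<psi>\<^sub>n(s)\<bar> \<le> (\<pi>\<^sub>m E R\<^sub>m + \<pi>\<^sub>m (c\<^sub>m + a\<^sub>m) / \<theta>) \<bar>s\<bar>\<close> for all \<open>m \<ge> n\<close>, and the right-hand side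
  tends to 0: \<open>\<pi>\<^sub>m E R\<^sub>m\<close> is a remainder of the convergent series \<open>\<Sum>\<^sub>j \<pi>\<^sub>j c\<^sub>j / \<theta>\<close>, \<open>\<pi>\<^sub>m c\<^sub>m / \<theta>\<close> is its
  general term, and \<open>\<pi>\<^sub>m a\<^sub>m\<close> tends to 0 by hypothesis.

  For joint independence (\<open>indep_Y\<close>), \<open>Y\<^sub>n\<close> is independent of \<open>R\<^sub>n\<close>, and the pair is independent of all
  \<open>G\<^sub>k\<close>, \<open>U\<^sub>k\<close> with \<open>k < n\<close>. These variables and \<open>R\<^sub>n\<close> determine \<open>R\<^sub>k\<close>, hence \<open>Y\<^sub>k\<close>, for all \<open>k < n\<close>, by the
  recursion; so \<open>Y\<^sub>n\<close> is independent of \<open>Y\<^sub>1, \<dots>, Y\<^sub>n\<^sub>-\<^sub>1\<close>.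
\<close>

section \<open>The beta-gamma algebra\<close>

text \<open>The gamma distribution with shape \<open>c\<close> and rate \<open>\<theta>\<close>, as a measure on the Borel sets.\<close>

definition gamma_law :: "real \<Rightarrow> real \<Rightarrow> real measure" where
  "gamma_law c \<theta> = density lborel (gamma_density c \<theta>)"

text \<open>The beta distribution with parameters \<open>a\<close> and \<open>b\<close>, as a measure on the Borel sets.\<close>

definition beta_law :: "real \<Rightarrow> real \<Rightarrow> real measure" where
  "beta_law a b = density lborel (beta_density a b)"

lemma sets_gamma_law [measurable_cong, simp]: "sets (gamma_law c \<theta>) = sets borel"
  and space_gamma_law [simp]: "space (gamma_law c \<theta>) = UNIV"
  by (simp_all add: gamma_law_def)

lemma sets_beta_law [measurable_cong, simp]: "sets (beta_law a b) = sets borel"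
  and space_beta_law [simp]: "space (beta_law a b) = UNIV"
  by (simp_all add: beta_law_def)

lemma prob_space_gamma_law: "0 < c \<Longrightarrow> 0 < \<theta> \<Longrightarrow> prob_space (gamma_law c \<theta>)"
  by (simp add: gamma_law_def prob_space_gamma_density)

lemma prob_space_beta_law: "0 < a \<Longrightarrow> 0 < b \<Longrightarrow> prob_space (beta_law a b)"
  by (simp add: beta_law_def prob_space_beta_density)

lemma AE_gamma_law_pos: "AE x in gamma_law c \<theta>. 0 < x"
  unfolding gamma_law_def by (subst AE_density) (auto simp: gamma_density_def)

lemma AE_beta_law_Ioo: "AE x in beta_law a b. 0 < x \<and> x < 1"
  unfolding beta_law_def by (subst AE_density) (auto simp: beta_density_def)

text \<open>
  The identity of densities behind all the beta-gamma algebra; the factor \<open>r\<close> is the Jacobian of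
  \<open>(r, x) \<mapsto> (r x, r (1 - x))\<close>.
\<close>

lemma gamma_density_factor:
  assumes "0 < a" "0 < b" "0 < \<theta>" "0 < r"
  shows "r * (gamma_density a \<theta> (r * x) * gamma_density b \<theta> (r * (1 - x))) =
    gamma_density (a + b) \<theta> r * beta_density a b x"
proof (cases "0 < x \<and> x < 1")
  case True
  have *: "r * (r powr (a - 1) * r powr (b - 1)) = r powr (a + b - 1)"
    using assms(4) by (simp add: powr_add powr_diff field_simps)
  have e: "exp (- \<theta> * (r * x)) * exp (- \<theta> * (r * (1 - x))) = exp (- \<theta> * r)"
    by (simp add: exp_add [symmetric] algebra_simps)
  have g: "Gamma a \<noteq> 0" "Gamma b \<noteq> 0" "Gamma (a + b) \<noteq> 0"
    using assms by (metis Gamma_real_pos add_pos_pos less_irrefl)+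
  have "r * (gamma_density a \<theta> (r * x) * gamma_density b \<theta> (r * (1 - x))) =
      (\<theta> powr a * \<theta> powr b) / (Gamma a * Gamma b) * (r * (r powr (a - 1) * r powr (b - 1)))
      * (x powr (a - 1) * (1 - x) powr (b - 1))
      * (exp (- \<theta> * (r * x)) * exp (- \<theta> * (r * (1 - x))))"
    using True assms by (simp add: gamma_density_def powr_mult)
  also have "\<dots> = gamma_density (a + b) \<theta> r * beta_density a b x"
    unfolding * e using True assms g
    by (simp add: gamma_density_def beta_density_def Beta_def powr_add)
  finally show ?thesis .
next
  case False
  then have "r * x \<le> 0 \<or> r * (1 - x) \<le> 0"
    using assms by (auto simp: mult_le_0_iff)
  with False show ?thesis
    by (auto simp: gamma_density_def beta_density_def)
qed

lemma nn_integral_gamma_law: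
  "f \<in> borel_measurable borel \<Longrightarrow>
    (\<integral>\<^sup>+x. f x \<partial>gamma_law c \<theta>) = (\<integral>\<^sup>+x. ennreal (gamma_density c \<theta> x) * f x \<partial>lborel)"
  by (simp add: gamma_law_def nn_integral_density)

lemma nn_integral_beta_law:
  "f \<in> borel_measurable borel \<Longrightarrow>
    (\<integral>\<^sup>+x. f x \<partial>beta_law a b) = (\<integral>\<^sup>+x. ennreal (beta_density a b x) * f x \<partial>lborel)"
  by (simp add: beta_law_def nn_integral_density)

text \<open>
  If \<open>R \<sim> gamma(a + b, \<theta>)\<close> and \<open>B \<sim> beta(a, b)\<close> are independent, then \<open>R B\<close> and \<open>R (1 - B)\<close> are
  independent with laws \<open>gamma(a, \<theta>)\<close> and \<open>gamma(b, \<theta>)\<close>. The change of variables is carried out in two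
  one-dimensional steps: a translation \<open>y = r - x\<close>, and, after exchanging the integrals, the
  scaling of \<open>x\<close> by \<open>r\<close>.
\<close>

lemma gamma_law_split:
  assumes "0 < a" "0 < b" "0 < \<theta>"
  shows "distr (gamma_law (a + b) \<theta> \<Otimes>\<^sub>M beta_law a b) (borel \<Otimes>\<^sub>M borel)
      (\<lambda>(r, x). (r * x, r * (1 - x))) = gamma_law a \<theta> \<Otimes>\<^sub>M gamma_law b \<theta>" (is "?L = ?R")
proof (rule measure_eqI)
  interpret B: prob_space "gamma_law b \<theta>" using assms by (intro prob_space_gamma_law)
  interpret AB: prob_space "gamma_law (a + b) \<theta>" using assms by (intro prob_space_gamma_law) auto
  interpret Be: prob_space "beta_law a b" using assms by (intro prob_space_beta_law)
  show sets: "sets ?L = sets ?R" by (simp cong: sets_pair_measure_cong)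
  fix E assume "E \<in> sets ?L"
  then have [measurable]: "E \<in> sets (borel \<Otimes>\<^sub>M borel)" by simp
  define ga gb gs be where "ga x = ennreal (gamma_density a \<theta> x)"
    and "gb x = ennreal (gamma_density b \<theta> x)"
    and "gs x = ennreal (gamma_density (a + b) \<theta> x)"
    and "be x = ennreal (beta_density a b x)" for x
  have [measurable]: "ga \<in> borel_measurable borel" "gb \<in> borel_measurable borel"
    "gs \<in> borel_measurable borel" "be \<in> borel_measurable borel"
    unfolding ga_def[abs_def] gb_def[abs_def] gs_def[abs_def] be_def[abs_def] by measurable
  \<comment> \<open>the set \<open>E\<close> as a curried test function\<close>
  define F :: "real \<Rightarrow> real \<Rightarrow> ennreal" where "F x y = indicator E (x, y)" for x y
  have [measurable]: "(\<lambda>z. F (f z) (g z)) \<in> borel_measurable N"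
    if [measurable]: "f \<in> borel_measurable N" "g \<in> borel_measurable N" for f g and N :: "'z measure"
    unfolding F_def by measurable
  have key: "(\<integral>\<^sup>+x. ga x * (gb (r - x) * F x (r - x)) \<partial>lborel) =
      gs r * (\<integral>\<^sup>+x. be x * F (r * x) (r * (1 - x)) \<partial>lborel)" for r
  proof (cases "0 < r")
    case True
    have "(\<integral>\<^sup>+x. ga x * (gb (r - x) * F x (r - x)) \<partial>lborel) =
        ennreal r * (\<integral>\<^sup>+x. ga (r * x) * (gb (r - r * x) * F (r * x) (r - r * x)) \<partial>lborel)"
      using nn_integral_real_affine[of "\<lambda>x. ga x * (gb (r - x) * F x (r - x))" r 0] True by simp
    also have "\<dots> = (\<integral>\<^sup>+x. ennreal r * (ga (r * x) * (gb (r - r * x) * F (r * x) (r - r * x))) \<partial>lborel)"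
      by (rule nn_integral_cmult [symmetric]) measurable
    also have "\<dots> = (\<integral>\<^sup>+x. gs r * (be x * F (r * x) (r * (1 - x))) \<partial>lborel)"
    proof (rule nn_integral_cong)
      fix x
      have "ennreal r * (ga (r * x) * gb (r * (1 - x))) = gs r * be x"
      proof -
        have "0 \<le> gamma_density a \<theta> (r * x)" "0 \<le> gamma_density b \<theta> (r * (1 - x))"
          "0 \<le> gamma_density (a + b) \<theta> r" "0 \<le> beta_density a b x"
          using assms by (auto intro: gamma_density_nonneg beta_density_nonneg)
        then show ?thesis
          unfolding ga_def gb_def gs_def be_def
          using gamma_density_factor[OF assms True, of x] True by (metis ennreal_mult mult_nonneg_nonneg less_imp_le)
      qed
      then show "ennreal r * (ga (r * x) * (gb (r - r * x) * F (r * x) (r - r * x))) =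
          gs r * (be x * F (r * x) (r * (1 - x)))"
        by (simp add: mult.assoc [symmetric] right_diff_distrib)
    qed
    also have "\<dots> = gs r * (\<integral>\<^sup>+x. be x * F (r * x) (r * (1 - x)) \<partial>lborel)"
      by (rule nn_integral_cmult) measurable
    finally show ?thesis .
  next
    case False
    then have *: "ga x * (gb (r - x) * F x (r - x)) = 0" for x
      by (simp add: ga_def gb_def gamma_density_def)
    from False show ?thesis unfolding * by (simp add: gs_def gamma_density_def)
  qed
  have "emeasure ?R E = (\<integral>\<^sup>+x. (\<integral>\<^sup>+y. F x y \<partial>gamma_law b \<theta>) \<partial>gamma_law a \<theta>)"
    unfolding F_def by (simp add: B.emeasure_pair_measure cong: sets_pair_measure_cong)
  also have "\<dots> = (\<integral>\<^sup>+x. ga x * (\<integral>\<^sup>+y. gb y * F x y \<partial>lborel) \<partial>lborel)"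
    unfolding ga_def gb_def by (simp add: nn_integral_gamma_law)
  also have "\<dots> = (\<integral>\<^sup>+x. ga x * (\<integral>\<^sup>+r. gb (r - x) * F x (r - x) \<partial>lborel) \<partial>lborel)"
  proof (rule nn_integral_cong)
    fix x show "ga x * (\<integral>\<^sup>+y. gb y * F x y \<partial>lborel) = ga x * (\<integral>\<^sup>+r. gb (r - x) * F x (r - x) \<partial>lborel)"
      using nn_integral_real_affine[of "\<lambda>y. gb y * F x y" 1 "-x"] by simp
  qed
  also have "\<dots> = (\<integral>\<^sup>+x. (\<integral>\<^sup>+r. ga x * (gb (r - x) * F x (r - x)) \<partial>lborel) \<partial>lborel)"
    by (simp add: nn_integral_cmult)
  also have "\<dots> = (\<integral>\<^sup>+r. (\<integral>\<^sup>+x. ga x * (gb (r - x) * F x (r - x)) \<partial>lborel) \<partial>lborel)"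
    by (rule lborel_pair.Fubini'[symmetric]) measurable
  also have "\<dots> = (\<integral>\<^sup>+r. gs r * (\<integral>\<^sup>+x. be x * F (r * x) (r * (1 - x)) \<partial>lborel) \<partial>lborel)"
    by (simp only: key)
  also have "\<dots> = (\<integral>\<^sup>+r. (\<integral>\<^sup>+x. F (r * x) (r * (1 - x)) \<partial>beta_law a b) \<partial>gamma_law (a + b) \<theta>)"
    unfolding gs_def be_def by (simp add: nn_integral_beta_law nn_integral_gamma_law)
  also have "\<dots> = (\<integral>\<^sup>+z. (case z of (r, x) \<Rightarrow> F (r * x) (r * (1 - x))) \<partial>(gamma_law (a + b) \<theta> \<Otimes>\<^sub>M beta_law a b))"
    by (subst Be.nn_integral_fst [symmetric]) (simp_all add: case_prod_beta')
  also have "\<dots> = emeasure ?L E"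
    unfolding F_def
    by (subst nn_integral_indicator[symmetric], simp, subst nn_integral_distr) (auto simp: case_prod_beta')
  finally show "emeasure ?L E = emeasure ?R E" ..
qed

text \<open>
  For independent \<open>G \<sim> gamma(c, \<theta>)\<close> and \<open>H \<sim> gamma(a, \<theta>)\<close>, the sum \<open>G + H\<close> and the ratio
  \<open>G / (G + H)\<close> are independent, because the map taking \<open>(G, H)\<close> to them inverts the splitting
  map of \<open>gamma_law_split\<close> wherever the sum is positive.
\<close>

lemma gamma_law_sum_ratio:
  assumes "0 < c" "0 < a" "0 < \<theta>"
  shows "distr (gamma_law c \<theta> \<Otimes>\<^sub>M gamma_law a \<theta>) (borel \<Otimes>\<^sub>M borel)
      (\<lambda>(g, h). (g + h, g / (g + h))) = gamma_law (c + a) \<theta> \<Otimes>\<^sub>M beta_law c a"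
    (is "distr _ _ ?f = ?R")
proof -
  interpret S: prob_space "gamma_law (c + a) \<theta>" using assms by (intro prob_space_gamma_law) auto
  interpret Be: prob_space "beta_law c a" using assms by (intro prob_space_beta_law)
  interpret P: pair_sigma_finite "gamma_law (c + a) \<theta>" "beta_law c a" ..
  let ?g = "\<lambda>(r, x). (r * x, r * (1 - x)) :: real \<times> real"
  have [measurable]: "?f \<in> borel \<Otimes>\<^sub>M borel \<rightarrow>\<^sub>M borel \<Otimes>\<^sub>M borel"
    "?g \<in> gamma_law (c + a) \<theta> \<Otimes>\<^sub>M beta_law c a \<rightarrow>\<^sub>M borel \<Otimes>\<^sub>M borel" by measurable
  have pos: "AE z in ?R. 0 < fst z"
    by (rule P.AE_pair_measure, measurable)
      (use AE_gamma_law_pos[of "c + a" \<theta>] in \<open>auto elim!: eventually_mono\<close>)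
  have "distr (gamma_law c \<theta> \<Otimes>\<^sub>M gamma_law a \<theta>) (borel \<Otimes>\<^sub>M borel) ?f
      = distr ?R (borel \<Otimes>\<^sub>M borel) (?f \<circ> ?g)"
    by (subst gamma_law_split[OF assms, symmetric]) (subst distr_distr, auto)
  also have "\<dots> = distr ?R ?R (\<lambda>z. z)"
    by (rule distr_cong_AE)
      (use pos in \<open>auto elim!: eventually_mono simp: algebra_simps cong: sets_pair_measure_cong\<close>)
  also have "\<dots> = ?R" by (rule distr_id)
  finally show ?thesis .
qed

lemma gamma_law_convolution:
  assumes "0 < c" "0 < a" "0 < \<theta>"
  shows "distr (gamma_law c \<theta> \<Otimes>\<^sub>M gamma_law a \<theta>) borel (\<lambda>(g, h). g + h) = gamma_law (c + a) \<theta>"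
proof -
  interpret Be: prob_space "beta_law c a" using assms by (intro prob_space_beta_law)
  have "distr (gamma_law c \<theta> \<Otimes>\<^sub>M gamma_law a \<theta>) borel (\<lambda>(g, h). g + h) =
      distr (distr (gamma_law c \<theta> \<Otimes>\<^sub>M gamma_law a \<theta>) (borel \<Otimes>\<^sub>M borel) (\<lambda>(g, h). (g + h, g / (g + h)))) borel fst"
    by (subst distr_distr) (auto simp: comp_def case_prod_beta')
  also have "\<dots> = gamma_law (c + a) \<theta>"
    unfolding gamma_law_sum_ratio[OF assms]
    using Be.distr_pair_fst[of "gamma_law (c + a) \<theta>"] by (simp cong: distr_cong)
  finally show ?thesis .
qed

text \<open>If \<open>U \<sim> beta(a, b)\<close> and \<open>T \<sim> gamma(a + b, \<theta>)\<close> are independent, then \<open>U T \<sim> gamma(a, \<theta>)\<close>.\<close>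

lemma beta_times_gamma:
  assumes "0 < a" "0 < b" "0 < \<theta>"
  shows "distr (beta_law a b \<Otimes>\<^sub>M gamma_law (a + b) \<theta>) borel (\<lambda>(u, t). u * t) = gamma_law a \<theta>"
proof -
  interpret B: prob_space "gamma_law b \<theta>" using assms by (intro prob_space_gamma_law)
  interpret AB: prob_space "gamma_law (a + b) \<theta>" using assms by (intro prob_space_gamma_law) auto
  interpret Be: prob_space "beta_law a b" using assms by (intro prob_space_beta_law)
  interpret P: pair_sigma_finite "gamma_law (a + b) \<theta>" "beta_law a b" ..
  have "distr (beta_law a b \<Otimes>\<^sub>M gamma_law (a + b) \<theta>) borel (\<lambda>(u, t). u * t) =
      distr (gamma_law (a + b) \<theta> \<Otimes>\<^sub>M beta_law a b) borel (\<lambda>(r, x). r * x)"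
  proof -
    interpret Q: pair_sigma_finite "beta_law a b" "gamma_law (a + b) \<theta>" ..
    show ?thesis
      by (subst Q.distr_pair_swap, subst distr_distr) (auto simp: comp_def case_prod_beta' mult.commute)
  qed
  also have "\<dots> = distr (gamma_law a \<theta> \<Otimes>\<^sub>M gamma_law b \<theta>) borel fst"
    by (subst gamma_law_split[OF assms, symmetric], subst distr_distr) (auto simp: comp_def case_prod_beta')
  also have "\<dots> = gamma_law a \<theta>"
    using B.distr_pair_fst[of "gamma_law a \<theta>"] by (simp cong: distr_cong)
  finally show ?thesis .
qed

lemma nn_integral_gamma_law_id:
  assumes "0 < c" "0 < \<theta>"
  shows "(\<integral>\<^sup>+x. ennreal x \<partial>gamma_law c \<theta>) = ennreal (c / \<theta>)"
proof -
  interpret prob_space "gamma_law (c + 1) \<theta>" using assms by (intro prob_space_gamma_law) auto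
  have g: "Gamma (c + 1) = c * Gamma c"
    using assms by (intro Gamma_plus1) (auto simp: nonpos_Ints_def)
  have "Gamma c > 0" using assms by (simp add: Gamma_real_pos)
  then have *: "gamma_density c \<theta> x * x = c / \<theta> * gamma_density (c + 1) \<theta> x" for x
    using assms by (auto simp: gamma_density_def g powr_add powr_diff)
  have "(\<integral>\<^sup>+x. ennreal x \<partial>gamma_law c \<theta>) =
      (\<integral>\<^sup>+x. ennreal (c / \<theta>) * (ennreal (gamma_density (c + 1) \<theta> x) * 1) \<partial>lborel)"
    using assms by (subst nn_integral_gamma_law, measurable, intro nn_integral_cong)
      (simp add: * gamma_density_nonneg flip: ennreal_mult ennreal_mult')
  also have "\<dots> = ennreal (c / \<theta>) * (\<integral>\<^sup>+x. 1 \<partial>gamma_law (c + 1) \<theta>)"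
    by (subst nn_integral_gamma_law, simp, rule nn_integral_cmult) measurable
  finally show ?thesis by (simp add: emeasure_space_1[simplified])
qed

lemma nn_integral_beta_law_id:
  assumes "0 < a" "0 < b"
  shows "(\<integral>\<^sup>+x. ennreal x \<partial>beta_law a b) = ennreal (a / (a + b))"
proof -
  interpret prob_space "beta_law (a + 1) b" using assms by (intro prob_space_beta_law) auto
  have g: "Beta (a + 1) b = a / (a + b) * Beta a b"
    using assms Beta_plus1_left[of a b] by (auto simp: nonpos_Ints_def field_simps)
  have "Beta a b > 0" using assms by (simp add: Beta_def Gamma_real_pos)
  then have *: "beta_density a b x * x = a / (a + b) * beta_density (a + 1) b x" for x
  proof (cases "0 < x \<and> x < 1")
    case True
    then have "x powr (a - 1) * x = x powr (a + 1 - 1)"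
      by (simp add: powr_diff)
    with True \<open>Beta a b > 0\<close> assms show ?thesis
      by (simp add: beta_density_def g)
  qed (auto simp: beta_density_def)
  have "(\<integral>\<^sup>+x. ennreal x \<partial>beta_law a b) =
      (\<integral>\<^sup>+x. ennreal (a / (a + b)) * (ennreal (beta_density (a + 1) b x) * 1) \<partial>lborel)"
    using assms by (subst nn_integral_beta_law, measurable, intro nn_integral_cong)
      (simp add: * beta_density_nonneg flip: ennreal_mult ennreal_mult')
  also have "\<dots> = ennreal (a / (a + b)) * (\<integral>\<^sup>+x. 1 \<partial>beta_law (a + 1) b)"
    by (subst nn_integral_beta_law, simp, rule nn_integral_cmult) measurable
  finally show ?thesis by (simp add: emeasure_space_1[simplified])
qed

section \<open>Independence\<close>

text \<open>
  The \<open>\<sigma>\<close>-algebra on \<open>\<Omega>\<close> generated by the random variables \<open>X i\<close> with \<open>i \<in> J\<close>. It is encoded as a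
  measure space (with the zero measure) so that measurability with respect to it can be expressed.
\<close>

definition sigma_gen :: "'w set \<Rightarrow> ('i \<Rightarrow> 'w \<Rightarrow> real) \<Rightarrow> 'i set \<Rightarrow> 'w measure" where
  "sigma_gen \<Omega> X J = sigma \<Omega> (\<Union>i\<in>J. {X i -` A \<inter> \<Omega> | A. A \<in> sets borel})"

lemma space_sigma_gen [simp]: "space (sigma_gen \<Omega> X J) = \<Omega>"
  by (auto simp: sigma_gen_def intro!: space_measure_of)

lemma sets_sigma_gen:
  "sets (sigma_gen \<Omega> X J) = sigma_sets \<Omega> (\<Union>i\<in>J. {X i -` A \<inter> \<Omega> | A. A \<in> sets borel})"
  by (auto simp: sigma_gen_def intro!: sets_measure_of)

lemma measurable_sigma_gen: "i \<in> J \<Longrightarrow> X i \<in> borel_measurable (sigma_gen \<Omega> X J)"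
  by (auto simp: measurable_def sets_sigma_gen)

lemma (in prob_space) sets_sigma_gen_subset:
  "(\<And>i. i \<in> J \<Longrightarrow> X i \<in> borel_measurable M) \<Longrightarrow> sets (sigma_gen (space M) X J) \<subseteq> events"
  unfolding sets_sigma_gen by (intro sets.sigma_sets_subset) auto

lemma (in prob_space) indep_vars_sigma_gen:
  assumes "indep_vars (\<lambda>_. borel) X I" "J \<subseteq> I" "K \<subseteq> I" "J \<inter> K = {}"
    and A: "A \<in> sets (sigma_gen (space M) X J)" and B: "B \<in> sets (sigma_gen (space M) X K)"
  shows "prob (A \<inter> B) = prob A * prob B"
proof -
  let ?E = "\<lambda>i. {X i -` A \<inter> space M | A. A \<in> sets borel}"
  have "indep_sets ?E I" using assms(1) by (simp add: indep_vars_def2)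
  then have "indep_sets ?E (\<Union>j\<in>UNIV. case_bool J K j)"
    by (rule indep_sets_mono_index[rotated]) (use assms(2,3) in \<open>auto simp: UNIV_bool\<close>)
  then have "indep_sets (\<lambda>j. sigma_sets (space M) (\<Union>i\<in>case_bool J K j. ?E i)) UNIV"
  proof (rule indep_sets_collect_sigma)
    show "Int_stable (?E i)" for i
      by (auto simp: Int_stable_def) (metis sets.Int vimage_Int Int_assoc Int_left_commute Int_absorb)
    show "disjoint_family_on (case_bool J K) UNIV"
      using assms(4) by (auto simp: disjoint_family_on_def split: bool.split)
  qed
  then have "indep_set (sets (sigma_gen (space M) X J)) (sets (sigma_gen (space M) X K))"
    unfolding indep_set_def
    by (rule indep_sets_cong[THEN iffD1, rotated -1]) (auto simp: sets_sigma_gen split: bool.split)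
  then show ?thesis using A B by (rule indep_setD)
qed

lemma (in prob_space) distr_pair_eqI:
  assumes [measurable]: "X \<in> measurable M S" "Y \<in> measurable M T"
    and indep: "\<And>A B. A \<in> sets S \<Longrightarrow> B \<in> sets T \<Longrightarrow>
      prob ((X -` A \<inter> space M) \<inter> (Y -` B \<inter> space M)) = prob (X -` A \<inter> space M) * prob (Y -` B \<inter> space M)"
  shows "distr M (S \<Otimes>\<^sub>M T) (\<lambda>\<omega>. (X \<omega>, Y \<omega>)) = distr M S X \<Otimes>\<^sub>M distr M T Y"
proof (rule pair_measure_eqI[symmetric])
  interpret X: prob_space "distr M S X" by (rule prob_space_distr) fact
  interpret Y: prob_space "distr M T Y" by (rule prob_space_distr) fact
  show "sigma_finite_measure (distr M S X)" "sigma_finite_measure (distr M T Y)" by unfold_locales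
  show "sets (distr M S X \<Otimes>\<^sub>M distr M T Y) = sets (distr M (S \<Otimes>\<^sub>M T) (\<lambda>\<omega>. (X \<omega>, Y \<omega>)))"
    by (simp cong: sets_pair_measure_cong)
  fix A B assume "A \<in> sets (distr M S X)" "B \<in> sets (distr M T Y)"
  then have [measurable]: "A \<in> sets S" "B \<in> sets T" by auto
  have "(\<lambda>\<omega>. (X \<omega>, Y \<omega>)) -` (A \<times> B) \<inter> space M = (X -` A \<inter> space M) \<inter> (Y -` B \<inter> space M)"
    by auto
  then show "emeasure (distr M S X) A * emeasure (distr M T Y) B =
      emeasure (distr M (S \<Otimes>\<^sub>M T) (\<lambda>\<omega>. (X \<omega>, Y \<omega>))) (A \<times> B)"
    by (simp add: emeasure_distr emeasure_eq_measure indep ennreal_mult)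
qed

lemma (in prob_space) distr_pair_sigma_gen:
  assumes ind: "indep_vars (\<lambda>_. borel) X I" "J \<subseteq> I" "K \<subseteq> I" "J \<inter> K = {}"
    and f: "f \<in> sigma_gen (space M) X J \<rightarrow>\<^sub>M S" and g: "g \<in> sigma_gen (space M) X K \<rightarrow>\<^sub>M T"
  shows "distr M (S \<Otimes>\<^sub>M T) (\<lambda>\<omega>. (f \<omega>, g \<omega>)) = distr M S f \<Otimes>\<^sub>M distr M T g"
proof (rule distr_pair_eqI)
  have "X i \<in> borel_measurable M" if "i \<in> I" for i
    using ind(1) that by (simp add: indep_vars_def2)
  then have "sets (sigma_gen (space M) X J) \<subseteq> events" "sets (sigma_gen (space M) X K) \<subseteq> events"
    using ind(2,3) by (auto intro!: sets_sigma_gen_subset)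
  then have "subalgebra M (sigma_gen (space M) X J)" "subalgebra M (sigma_gen (space M) X K)"
    by (simp_all add: subalgebra_def)
  then show "f \<in> M \<rightarrow>\<^sub>M S" "g \<in> M \<rightarrow>\<^sub>M T"
    using f g by (auto intro: measurable_from_subalg)
next
  fix A B assume "A \<in> sets S" "B \<in> sets T"
  then show "prob ((f -` A \<inter> space M) \<inter> (g -` B \<inter> space M)) =
      prob (f -` A \<inter> space M) * prob (g -` B \<inter> space M)"
    using measurable_sets[OF f] measurable_sets[OF g] by (intro indep_vars_sigma_gen[OF ind]) auto
qed

text \<open>
  A family is independent if each member is independent of a \<open>\<sigma>\<close>-algebra for which all earlier
  members are measurable; these \<open>\<sigma>\<close>-algebras need not be increasing.
\<close>

lemma (in prob_space) indep_varsI_past: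
  fixes Y :: "'i :: linorder \<Rightarrow> 'a \<Rightarrow> real" and F :: "'i \<Rightarrow> 'a measure"
  assumes Y [measurable]: "\<And>n. n \<in> I \<Longrightarrow> Y n \<in> borel_measurable M"
    and space: "\<And>n. n \<in> I \<Longrightarrow> space (F n) = space M"
    and past: "\<And>k n. k \<in> I \<Longrightarrow> n \<in> I \<Longrightarrow> k < n \<Longrightarrow> Y k \<in> borel_measurable (F n)"
    and indep: "\<And>n A B. n \<in> I \<Longrightarrow> A \<in> sets (F n) \<Longrightarrow> B \<in> sets borel \<Longrightarrow>
      prob (A \<inter> (Y n -` B \<inter> space M)) = prob A * prob (Y n -` B \<inter> space M)"
  shows "indep_vars (\<lambda>_. borel) Y I"
proof -
  let ?E = "\<lambda>i. {Y i -` A \<inter> space M | A. A \<in> sets borel}"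
  have main: "prob (space M \<inter> (\<Inter>j\<in>J. A j)) = (\<Prod>j\<in>J. prob (A j))"
    if "finite J" "J \<subseteq> I" "A \<in> Pi J ?E" for J A
    using that
  proof (induction J rule: finite_linorder_max_induct)
    case (insert n J)
    then obtain B where B: "A n = Y n -` B \<inter> space M" "B \<in> sets borel" by auto
    have "A k \<in> sets (F n)" if "k \<in> J" for k
    proof -
      obtain C where C: "A k = Y k -` C \<inter> space M" "C \<in> sets borel"
        using insert.prems(2) \<open>k \<in> J\<close> by (auto simp: Pi_iff)
      have "Y k -` C \<inter> space (F n) \<in> sets (F n)"
        using insert \<open>k \<in> J\<close> C by (intro measurable_sets[OF past]) auto
      with C insert.prems space show ?thesis by simp
    qed
    then have "space (F n) \<inter> (\<Inter>j\<in>J. A j) \<in> sets (F n)"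
      using \<open>finite J\<close> by (cases "J = {}") (auto intro!: sets.Int sets.finite_INT)
    then have "prob ((space M \<inter> (\<Inter>j\<in>J. A j)) \<inter> A n) = prob (space M \<inter> (\<Inter>j\<in>J. A j)) * prob (A n)"
      using B insert.prems space by (simp add: indep)
    moreover have "space M \<inter> (\<Inter>j\<in>insert n J. A j) = (space M \<inter> (\<Inter>j\<in>J. A j)) \<inter> A n" by auto
    moreover have "n \<notin> J" using insert by auto
    ultimately show ?case using insert by simp
  qed (simp add: prob_space)
  show ?thesis
    unfolding indep_vars_def2
  proof (intro conjI ballI indep_setsI)
    fix A J assume J: "J \<noteq> {}" "J \<subseteq> I" "finite J" "\<forall>j\<in>J. A j \<in> ?E j"
    have "A j \<subseteq> space M" if "j \<in> J" for j using J(4) that by auto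
    with J(1) have "space M \<inter> (\<Inter>j\<in>J. A j) = (\<Inter>j\<in>J. A j)" by blast
    with main[of J A] J show "prob (\<Inter>j\<in>J. A j) = (\<Prod>j\<in>J. prob (A j))" by auto
  qed auto
qed

section \<open>Characteristic functions of sums and products\<close>

lemma char_sum_law:
  assumes "prob_space \<kappa>" "prob_space \<mu>" and [measurable_cong, simp]: "sets \<kappa> = sets borel" "sets \<mu> = sets borel"
  shows "char (distr (\<kappa> \<Otimes>\<^sub>M \<mu>) borel (\<lambda>(x, y). x + y)) s = char \<kappa> s * char \<mu> s"
proof -
  interpret K: prob_space \<kappa> by fact
  interpret L: prob_space \<mu> by fact
  interpret P: pair_prob_space \<kappa> \<mu> ..
  have "integrable (\<kappa> \<Otimes>\<^sub>M \<mu>) (\<lambda>(x, y). iexp (s * (x + y)))"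
    by (rule P.P.integrable_const_bound[of _ 1]) (auto simp: case_prod_beta')
  then have "(CLINT z|\<kappa> \<Otimes>\<^sub>M \<mu>. (case z of (x, y) \<Rightarrow> iexp (s * (x + y)))) =
      (CLINT x|\<kappa>. (CLINT y|\<mu>. iexp (s * (x + y))))"
    by (simp add: P.integral_fst'[symmetric])
  also have "\<dots> = (CLINT x|\<kappa>. (CLINT y|\<mu>. iexp (s * x) * iexp (s * y)))"
    by (simp add: exp_add[symmetric] algebra_simps)
  finally show ?thesis
    by (simp add: char_def integral_distr case_prod_beta')
qed

lemma char_product_law:
  assumes "prob_space \<beta>" "prob_space \<mu>" and [measurable_cong, simp]: "sets \<beta> = sets borel" "sets \<mu> = sets borel"
  shows "char (distr (\<beta> \<Otimes>\<^sub>M \<mu>) borel (\<lambda>(u, z). u * z)) s = (CLINT u|\<beta>. char \<mu> (s * u))"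
proof -
  interpret K: prob_space \<beta> by fact
  interpret L: prob_space \<mu> by fact
  interpret P: pair_prob_space \<beta> \<mu> ..
  have "integrable (\<beta> \<Otimes>\<^sub>M \<mu>) (\<lambda>(u, z). iexp (s * (u * z)))"
    by (rule P.P.integrable_const_bound[of _ 1]) (auto simp: case_prod_beta')
  then have "(CLINT z|\<beta> \<Otimes>\<^sub>M \<mu>. (case z of (u, z) \<Rightarrow> iexp (s * (u * z)))) =
      (CLINT u|\<beta>. (CLINT z|\<mu>. iexp (s * (u * z))))"
    by (simp add: P.integral_fst'[symmetric])
  then show ?thesis
    by (simp add: char_def integral_distr case_prod_beta' mult.assoc)
qed

text \<open>
  Measure the distance of two laws by the supremum over \<open>s \<noteq> 0\<close> of \<open>\<bar>char \<mu> s - char \<nu> s\<bar> / \<bar>s\<bar>\<close>.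
  Multiplication by an independent factor with first absolute moment \<open>m\<close> scales it by at most \<open>m\<close>.
\<close>

lemma char_product_law_contraction:
  assumes "prob_space \<beta>" "real_distribution \<mu>" "real_distribution \<nu>"
    and [measurable_cong, simp]: "sets \<beta> = sets borel"
    and m: "(\<integral>\<^sup>+u. ennreal \<bar>u\<bar> \<partial>\<beta>) = ennreal m" "0 \<le> m"
    and K: "\<And>s. cmod (char \<mu> s - char \<nu> s) \<le> K * \<bar>s\<bar>"
  shows "cmod (char (distr (\<beta> \<Otimes>\<^sub>M \<mu>) borel (\<lambda>(u, z). u * z)) s -
    char (distr (\<beta> \<Otimes>\<^sub>M \<nu>) borel (\<lambda>(u, z). u * z)) s) \<le> K * m * \<bar>s\<bar>"
proof -
  interpret B: prob_space \<beta> by fact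
  interpret M: real_distribution \<mu> by fact
  interpret N: real_distribution \<nu> by fact
  have i: "integrable \<beta> (\<lambda>u. \<bar>u\<bar>)" and v: "(LINT u|\<beta>. \<bar>u\<bar>) = m"
    using m by (auto intro!: integrableI_nn_integral_finite[of _ _ m] simp: integral_eq_nn_integral)
  have im: "integrable \<beta> (\<lambda>u. char \<mu> (s * u))" "integrable \<beta> (\<lambda>u. char \<nu> (s * u))"
    by (auto intro!: B.integrable_const_bound[of _ 1] M.cmod_char_le_1 N.cmod_char_le_1)
  have K': "cmod (char \<mu> (s * u) - char \<nu> (s * u)) \<le> K * \<bar>s\<bar> * \<bar>u\<bar>" for u
    using K[of "s * u"] by (simp add: abs_mult mult.assoc)
  have "cmod (CLINT u|\<beta>. char \<mu> (s * u) - char \<nu> (s * u)) \<le> (LINT u|\<beta>. K * \<bar>s\<bar> * \<bar>u\<bar>)"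
    using im i by (intro Bochner_Integration.integral_norm_bound_integral K')  auto
  also have "\<dots> = K * m * \<bar>s\<bar>" using v by simp
  finally show ?thesis
    using im assms by (simp add: char_product_law M.prob_space_axioms N.prob_space_axioms)
qed

lemma cmod_char_minus_1_le:
  assumes "real_distribution \<mu>" and m: "(\<integral>\<^sup>+x. ennreal \<bar>x\<bar> \<partial>\<mu>) = ennreal m" "0 \<le> m"
  shows "cmod (char \<mu> s - 1) \<le> m * \<bar>s\<bar>"
proof -
  interpret M: real_distribution \<mu> by fact
  have i: "integrable \<mu> (\<lambda>u. \<bar>u\<bar>)" and v: "(LINT u|\<mu>. \<bar>u\<bar>) = m"
    using m by (auto intro!: integrableI_nn_integral_finite[of _ _ m] simp: integral_eq_nn_integral)
  have ii: "integrable \<mu> (\<lambda>x. iexp (s * x))"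
    by (auto intro!: M.integrable_const_bound[of _ 1])
  have "cmod (CLINT x|\<mu>. iexp (s * x) - 1) \<le> (LINT x|\<mu>. \<bar>s\<bar> * \<bar>x\<bar>)"
  proof (rule Bochner_Integration.integral_norm_bound_integral)
    show "cmod (iexp (s * x) - 1) \<le> \<bar>s\<bar> * \<bar>x\<bar>" for x
      using iexp_approx1[of "s * x" 0] by (simp add: abs_mult)
  qed (use ii i in auto)
  also have "\<dots> = m * \<bar>s\<bar>" using v by simp
  finally show ?thesis
    using ii M.prob_space by (simp add: char_def)
qed

section \<open>Tails of the series and their ratios\<close>

text \<open>
  All families are indexed from 1. The gamma and beta variables are joined into one independent
  family indexed by a disjoint sum, and \<open>p n\<close> is the expectation of \<open>\<Prod>l = 1..<n. U l\<close>.
\<close>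

locale gamma_beta_series = prob_space M for M :: "'w measure" +
  fixes \<theta> :: real and a b c p :: "nat \<Rightarrow> real" and G U :: "nat \<Rightarrow> 'w \<Rightarrow> real"
  assumes theta_pos: "0 < \<theta>"
    and a_pos: "1 \<le> n \<Longrightarrow> 0 < a n"
    and b_pos: "1 \<le> n \<Longrightarrow> 0 < b n"
    and c_pos: "1 \<le> n \<Longrightarrow> 0 < c n"
    and shapes: "1 \<le> n \<Longrightarrow> a n + b n = c (Suc n) + a (Suc n)"
    and p_eq: "1 \<le> n \<Longrightarrow> p n = (\<Prod>l = 1..<n. a l / (a l + b l))"
    and summable_pc: "summable (\<lambda>n. p (Suc n) * c (Suc n))"
    and pa_tendsto: "(\<lambda>n. p n * a n) \<longlonglongrightarrow> 0"
    and law_G: "1 \<le> n \<Longrightarrow> distr M borel (G n) = gamma_law (c n) \<theta>"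
    and law_U: "1 \<le> n \<Longrightarrow> distr M borel (U n) = beta_law (a n) (b n)"
    and indep: "indep_vars (\<lambda>_. borel) (case_sum G U) ({1..} <+> {1..})"
begin

abbreviation X :: "nat + nat \<Rightarrow> 'w \<Rightarrow> real" where "X \<equiv> case_sum G U"

text \<open>
  The tail series \<open>G n + U n G (n + 1) + U n U (n + 1) G (n + 2) + \<dots>\<close>. It takes extended values so
  that its recursion holds at every point of the sample space, not only where the series converges. The coercion truncates negative values to 0, which matters
  only on a null event.
\<close>

definition Z :: "nat \<Rightarrow> 'w \<Rightarrow> ennreal" where
  "Z n \<omega> = (\<Sum>k. ennreal (G (n + k) \<omega>) * (\<Prod>l = n..<n + k. ennreal (U l \<omega>)))"

text \<open>The real-valued tail; it has the junk value 0 on the null event where \<open>Z n\<close> is infinite.\<close>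

definition R :: "nat \<Rightarrow> 'w \<Rightarrow> real" where "R n \<omega> = enn2real (Z n \<omega>)"

text \<open>The stick-breaking ratios.\<close>

definition Y :: "nat \<Rightarrow> 'w \<Rightarrow> real" where "Y n \<omega> = G n \<omega> / R n \<omega>"

lemma Z_rec: "Z n \<omega> = ennreal (G n \<omega>) + ennreal (U n \<omega>) * Z (Suc n) \<omega>"
proof -
  have "Z n \<omega> = (\<Sum>k. ennreal (G (n + (k + 1)) \<omega>) * (\<Prod>l = n..<n + (k + 1). ennreal (U l \<omega>))) + ennreal (G n \<omega>)"
    unfolding Z_def by (subst suminf_offset[of _ 1]) auto
  also have "(\<lambda>k. ennreal (G (n + (k + 1)) \<omega>) * (\<Prod>l = n..<n + (k + 1). ennreal (U l \<omega>))) =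
      (\<lambda>k. ennreal (U n \<omega>) * (ennreal (G (Suc n + k) \<omega>) * (\<Prod>l = Suc n..<Suc n + k. ennreal (U l \<omega>))))"
    by (rule ext, subst prod.atLeast_Suc_lessThan) (auto simp: mult_ac)
  finally show ?thesis by (simp add: Z_def add.commute)
qed

lemma measurable_G [measurable]: "1 \<le> n \<Longrightarrow> G n \<in> borel_measurable M"
  and measurable_U [measurable]: "1 \<le> n \<Longrightarrow> U n \<in> borel_measurable M"
  using indep by (force simp: indep_vars_def2)+

text \<open>The \<open>\<sigma>\<close>-algebras of the variables with index at least \<open>n\<close>, and with index less than \<open>n\<close>.\<close>

abbreviation tail :: "nat \<Rightarrow> 'w measure" where "tail n \<equiv> sigma_gen (space M) X ({n..} <+> {n..})"

abbreviation past :: "nat \<Rightarrow> 'w measure" where "past n \<equiv> sigma_gen (space M) X ({1..<n} <+> {1..<n})"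

lemma G_sigma_gen: "Inl n \<in> J \<Longrightarrow> G n \<in> borel_measurable (sigma_gen (space M) X J)"
  and U_sigma_gen: "Inr n \<in> J \<Longrightarrow> U n \<in> borel_measurable (sigma_gen (space M) X J)"
  using measurable_sigma_gen[of "Inl n" J X "space M"] measurable_sigma_gen[of "Inr n" J X "space M"] by auto

lemma Z_sigma_gen:
  assumes "{n..} <+> {n..} \<subseteq> J"
  shows "Z n \<in> borel_measurable (sigma_gen (space M) X J)"
proof -
  have [measurable]: "G (n + k) \<in> borel_measurable (sigma_gen (space M) X J)" for k
    using assms by (intro G_sigma_gen) auto
  have [measurable]: "U l \<in> borel_measurable (sigma_gen (space M) X J)" if "l \<in> {n..<m}" for l m
    using assms that by (intro U_sigma_gen) auto
  show ?thesis unfolding Z_def[abs_def] by measurable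
qed

lemma R_sigma_gen:
  "{n..} <+> {n..} \<subseteq> J \<Longrightarrow> R n \<in> borel_measurable (sigma_gen (space M) X J)"
  unfolding R_def[abs_def] by (intro measurable_compose[OF Z_sigma_gen]) auto

lemma subalgebra_sigma_gen:
  assumes "J \<subseteq> {1..} <+> {1..}"
  shows "subalgebra M (sigma_gen (space M) X J)"
proof -
  have "sets (sigma_gen (space M) X J) \<subseteq> events"
    using indep assms by (intro sets_sigma_gen_subset) (auto simp: indep_vars_def2)
  then show ?thesis by (simp add: subalgebra_def)
qed

lemma measurable_Z [measurable]: "1 \<le> n \<Longrightarrow> Z n \<in> borel_measurable M"
  by (rule measurable_from_subalg[OF subalgebra_sigma_gen Z_sigma_gen[OF order_refl]]) auto

lemma measurable_R [measurable]: "1 \<le> n \<Longrightarrow> R n \<in> borel_measurable M"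
  unfolding R_def[abs_def] by measurable

lemma measurable_Y [measurable]: "1 \<le> n \<Longrightarrow> Y n \<in> borel_measurable M"
  unfolding Y_def[abs_def] by measurable

lemma AE_G_pos: "1 \<le> n \<Longrightarrow> AE \<omega> in M. 0 < G n \<omega>"
  by (rule AE_distrD[of "G n" M borel], simp) (subst law_G, simp, rule AE_gamma_law_pos)

lemma AE_U_Ioo: "1 \<le> n \<Longrightarrow> AE \<omega> in M. 0 < U n \<omega> \<and> U n \<omega> < 1"
  by (rule AE_distrD[of "U n" M borel], simp) (subst law_U, simp, rule AE_beta_law_Ioo)

subsection \<open>Expectations\<close>

lemma p_Suc: "1 \<le> n \<Longrightarrow> p (Suc n) = p n * (a n / (a n + b n))"
  by (simp add: p_eq prod.atLeastLessThan_Suc)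

lemma p_pos: "1 \<le> n \<Longrightarrow> 0 < p n"
  by (auto simp: p_eq intro!: prod_pos divide_pos_pos add_pos_pos a_pos b_pos)

lemma p_add: "1 \<le> n \<Longrightarrow> p (n + k) = p n * (\<Prod>l = n..<n + k. a l / (a l + b l))"
  by (induction k) (auto simp: p_Suc prod.atLeastLessThan_Suc)

lemma nn_integral_G: "1 \<le> n \<Longrightarrow> (\<integral>\<^sup>+\<omega>. ennreal (G n \<omega>) \<partial>M) = ennreal (c n / \<theta>)"
  using nn_integral_gamma_law_id[of "c n" \<theta>] c_pos theta_pos
  by (simp add: law_G[symmetric] nn_integral_distr)

lemma nn_integral_U: "1 \<le> n \<Longrightarrow> (\<integral>\<^sup>+\<omega>. ennreal (U n \<omega>) \<partial>M) = ennreal (a n / (a n + b n))"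
  using nn_integral_beta_law_id[of "a n" "b n"] a_pos b_pos
  by (simp add: law_U[symmetric] nn_integral_distr)

lemma nn_integral_summand:
  assumes n: "1 \<le> n"
  shows "(\<integral>\<^sup>+\<omega>. ennreal (G (n + k) \<omega>) * (\<Prod>l = n..<n + k. ennreal (U l \<omega>)) \<partial>M) =
    ennreal (p (n + k) * c (n + k) / \<theta> / p n)"
proof -
  let ?J = "insert (Inl (n + k)) (Inr ` {n..<n + k}) :: (nat + nat) set"
  have prod_J: "(\<Prod>i\<in>?J. f i) = f (Inl (n + k)) * (\<Prod>l = n..<n + k. f (Inr l))"
    for f :: "nat + nat \<Rightarrow> ennreal"
    by (subst prod.insert) (auto simp: prod.reindex)
  have "indep_vars (\<lambda>_. borel) (\<lambda>i \<omega>. ennreal (X i \<omega>)) ({1..} <+> {1..})"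
    by (rule indep_vars_compose2[OF indep]) auto
  then have "indep_vars (\<lambda>_. borel) (\<lambda>i \<omega>. ennreal (X i \<omega>)) ?J"
    by (rule indep_vars_subset) (use n in auto)
  then have "(\<integral>\<^sup>+\<omega>. (\<Prod>i\<in>?J. ennreal (X i \<omega>)) \<partial>M) = (\<Prod>i\<in>?J. (\<integral>\<^sup>+\<omega>. ennreal (X i \<omega>) \<partial>M))"
    by (intro indep_vars_nn_integral) auto
  also have "\<dots> = ennreal (c (n + k) / \<theta>) * (\<Prod>l = n..<n + k. ennreal (a l / (a l + b l)))"
    unfolding prod_J using n by (auto simp: nn_integral_G nn_integral_U intro!: prod.cong)
  also have "(\<Prod>l = n..<n + k. ennreal (a l / (a l + b l))) = ennreal (\<Prod>l = n..<n + k. a l / (a l + b l))"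
  proof (rule prod_ennreal)
    fix l assume "l \<in> {n..<n + k}"
    with n have "0 < a l" "0 < b l" by (auto intro: a_pos b_pos)
    then show "0 \<le> a l / (a l + b l)" by simp
  qed
  also have "(\<Prod>l = n..<n + k. a l / (a l + b l)) = p (n + k) / p n"
    using p_add[OF n, of k] p_pos[OF n] by simp
  also have "ennreal (c (n + k) / \<theta>) * ennreal (p (n + k) / p n) = ennreal (p (n + k) * c (n + k) / \<theta> / p n)"
    using n p_pos[OF n] p_pos[of "n + k"] c_pos[of "n + k"] theta_pos
    by (subst ennreal_mult[symmetric]) (auto simp: field_simps)
  finally show ?thesis unfolding prod_J by simp
qed

text \<open>The expectation of \<open>Z n\<close>, scaled by \<open>p n\<close>: the remainder of a convergent series.\<close>

definition scaled_mean :: "nat \<Rightarrow> real" where "scaled_mean n = (\<Sum>k. p (n + k) * c (n + k)) / \<theta>"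

lemma summable_tail: "1 \<le> n \<Longrightarrow> summable (\<lambda>k. p (n + k) * c (n + k))"
  using summable_ignore_initial_segment[OF summable_pc, of "n - 1"] by (simp add: add.commute)

lemma scaled_mean_nonneg: "1 \<le> n \<Longrightarrow> 0 \<le> scaled_mean n"
  unfolding scaled_mean_def using theta_pos p_pos c_pos
  by (intro divide_nonneg_pos suminf_nonneg summable_tail) (auto intro!: mult_nonneg_nonneg less_imp_le)

lemma nn_integral_Z:
  assumes n: "1 \<le> n"
  shows "(\<integral>\<^sup>+\<omega>. Z n \<omega> \<partial>M) = ennreal (scaled_mean n / p n)"
proof -
  have [measurable]: "U l \<in> borel_measurable M" if "l \<in> {n..<m}" for l m
    using n that by (intro measurable_U) auto
  have [measurable]: "G (n + k) \<in> borel_measurable M" for k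
    using n by (intro measurable_G) auto
  have m: "(\<lambda>\<omega>. ennreal (G (n + k) \<omega>) * (\<Prod>l = n..<n + k. ennreal (U l \<omega>))) \<in> borel_measurable M" for k
    by measurable
  have "(\<integral>\<^sup>+\<omega>. Z n \<omega> \<partial>M) = (\<Sum>k. ennreal (p (n + k) * c (n + k) / \<theta> / p n))"
    unfolding Z_def by (simp only: nn_integral_suminf[OF m] nn_integral_summand[OF n])
  also have "\<dots> = ennreal (\<Sum>k. p (n + k) * c (n + k) / \<theta> / p n)"
  proof (rule suminf_ennreal2)
    show "0 \<le> p (n + k) * c (n + k) / \<theta> / p n" for k
      using n p_pos[OF n] p_pos[of "n + k"] c_pos[of "n + k"] theta_pos by simp
  qed (intro summable_divide summable_tail n)
  also have "(\<Sum>k. p (n + k) * c (n + k) / \<theta> / p n) = scaled_mean n / p n"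
    using n by (simp add: scaled_mean_def suminf_divide summable_tail summable_divide)
  finally show ?thesis .
qed

lemma AE_Z_finite: "1 \<le> n \<Longrightarrow> AE \<omega> in M. Z n \<omega> < top"
  using nn_integral_noteq_infinite[of "Z n" M] by (simp add: nn_integral_Z less_top)

lemma nn_integral_R: "1 \<le> n \<Longrightarrow> (\<integral>\<^sup>+\<omega>. ennreal \<bar>R n \<omega>\<bar> \<partial>M) = ennreal (scaled_mean n / p n)"
  unfolding nn_integral_Z[symmetric]
  by (rule nn_integral_cong_AE) (use AE_Z_finite[of n] in \<open>auto simp: R_def elim!: eventually_mono\<close>)

lemma scaled_mean_tendsto: "scaled_mean \<longlonglongrightarrow> 0"
proof (rule LIMSEQ_imp_Suc)
  let ?f = "\<lambda>n. p (Suc n) * c (Suc n)"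
  have "scaled_mean (Suc m) = (suminf ?f - (\<Sum>k<m. ?f k)) / \<theta>" for m
    using suminf_minus_initial_segment[OF summable_pc, of m] by (simp add: scaled_mean_def add.commute)
  moreover have "(\<lambda>m. (suminf ?f - (\<Sum>k<m. ?f k)) / \<theta>) \<longlonglongrightarrow> (suminf ?f - suminf ?f) / \<theta>"
    using theta_pos by (intro tendsto_intros summable_LIMSEQ summable_pc) auto
  ultimately show "(\<lambda>m. scaled_mean (Suc m)) \<longlonglongrightarrow> 0" by simp
qed

subsection \<open>The law of the tails\<close>

lemma R_rec: "1 \<le> n \<Longrightarrow> AE \<omega> in M. R n \<omega> = G n \<omega> + U n \<omega> * R (Suc n) \<omega>"
proof -
  assume n: "1 \<le> n"
  have "AE \<omega> in M. Z (Suc n) \<omega> < top" using n by (intro AE_Z_finite) auto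
  with AE_G_pos[OF n] AE_U_Ioo[OF n] show ?thesis
  proof eventually_elim
    case (elim \<omega>)
    then have "Z n \<omega> = ennreal (G n \<omega>) + ennreal (U n \<omega> * R (Suc n) \<omega>)"
      unfolding R_def by (subst Z_rec) (simp add: ennreal_mult less_top)
    also have "\<dots> = ennreal (G n \<omega> + U n \<omega> * R (Suc n) \<omega>)"
      using elim by (subst ennreal_plus) (simp_all add: R_def)
    finally have "R n \<omega> = enn2real (ennreal (G n \<omega> + U n \<omega> * R (Suc n) \<omega>))"
      by (simp only: R_def[of n])
    moreover have "0 \<le> G n \<omega> + U n \<omega> * R (Suc n) \<omega>" using elim by (simp add: R_def)
    ultimately show ?case by simp
  qed
qed

lemma law_UR:
  assumes n: "1 \<le> n"
  shows "distr M borel (\<lambda>\<omega>. U n \<omega> * R (Suc n) \<omega>) =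
    distr (beta_law (a n) (b n) \<Otimes>\<^sub>M distr M borel (R (Suc n))) borel (\<lambda>(u, z). u * z)"
proof -
  have "distr M (borel \<Otimes>\<^sub>M borel) (\<lambda>\<omega>. (U n \<omega>, R (Suc n) \<omega>)) =
      beta_law (a n) (b n) \<Otimes>\<^sub>M distr M borel (R (Suc n))"
    unfolding law_U[OF n, symmetric]
    by (rule distr_pair_sigma_gen[OF indep, of "{Inr n}" "{Suc n..} <+> {Suc n..}"])
      (use n in \<open>auto intro: U_sigma_gen R_sigma_gen\<close>)
  then show ?thesis
    using n by (simp add: distr_distr comp_def flip: \<open>distr M (borel \<Otimes>\<^sub>M borel) _ = _\<close>)
qed

lemma law_G_UR:
  assumes n: "1 \<le> n"
  shows "distr M (borel \<Otimes>\<^sub>M borel) (\<lambda>\<omega>. (G n \<omega>, U n \<omega> * R (Suc n) \<omega>)) =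
    gamma_law (c n) \<theta> \<Otimes>\<^sub>M distr M borel (\<lambda>\<omega>. U n \<omega> * R (Suc n) \<omega>)"
  unfolding law_G[OF n, symmetric]
  by (rule distr_pair_sigma_gen[OF indep, of "{Inl n}" "insert (Inr n) ({Suc n..} <+> {Suc n..})"])
    (use n in \<open>auto intro!: G_sigma_gen borel_measurable_times U_sigma_gen R_sigma_gen\<close>)

text \<open>
  \<open>\<phi> n\<close> is the characteristic function of the tail, and \<open>\<psi> n\<close> that of the gamma law which the tail
  will be shown to have.
\<close>

abbreviation \<phi> :: "nat \<Rightarrow> real \<Rightarrow> complex" where "\<phi> n \<equiv> char (distr M borel (R n))"
abbreviation \<psi> :: "nat \<Rightarrow> real \<Rightarrow> complex" where "\<psi> n \<equiv> char (gamma_law (c n + a n) \<theta>)"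

lemma real_distribution_gamma_law: "0 < d \<Longrightarrow> real_distribution (gamma_law d \<theta>)"
  using theta_pos by (simp add: real_distribution_def real_distribution_axioms_def prob_space_gamma_law)

lemma real_distribution_R: "1 \<le> n \<Longrightarrow> real_distribution (distr M borel (R n))"
  by (rule real_distribution_distr) simp

text \<open>
  The tail laws and the gamma laws satisfy the same recursion in distribution: the former by
  \<open>R_rec\<close>, the latter by the beta-gamma algebra. The independent summand \<open>G n\<close> does not increase the
  distance of characteristic functions, and the factor \<open>U n\<close> multiplies it by its mean.
\<close>

lemma char_step:
  assumes n: "1 \<le> n" and K: "\<And>s. cmod (\<phi> (Suc n) s - \<psi> (Suc n) s) \<le> K * \<bar>s\<bar>"
  shows "cmod (\<phi> n s - \<psi> n s) \<le> K * (a n / (a n + b n)) * \<bar>s\<bar>"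
proof -
  note pos = a_pos[OF n] b_pos[OF n] c_pos[OF n] theta_pos
  interpret C: real_distribution "gamma_law (c n) \<theta>" using pos by (intro real_distribution_gamma_law)
  let ?H = "\<lambda>\<mu>. distr (beta_law (a n) (b n) \<Otimes>\<^sub>M \<mu>) borel (\<lambda>(u, z). u * z)"
  have "distr M borel (R n) = distr M borel (\<lambda>\<omega>. G n \<omega> + U n \<omega> * R (Suc n) \<omega>)"
    using n R_rec[OF n] by (intro distr_cong_AE) auto
  also have "\<dots> = distr (gamma_law (c n) \<theta> \<Otimes>\<^sub>M distr M borel (\<lambda>\<omega>. U n \<omega> * R (Suc n) \<omega>)) borel (\<lambda>(x, y). x + y)"
    unfolding law_G_UR[OF n, symmetric] using n by (simp add: distr_distr comp_def)
  finally have "\<phi> n s = char (gamma_law (c n) \<theta>) s * char (?H (distr M borel (R (Suc n)))) s"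
    unfolding law_UR[OF n, symmetric] using n
    by (simp add: char_sum_law C.prob_space_axioms prob_space_distr)
  moreover have "\<psi> n s = char (gamma_law (c n) \<theta>) s * char (?H (gamma_law (c (Suc n) + a (Suc n)) \<theta>)) s"
  proof -
    have "?H (gamma_law (c (Suc n) + a (Suc n)) \<theta>) = gamma_law (a n) \<theta>"
      unfolding shapes[OF n, symmetric] using pos by (intro beta_times_gamma)
    moreover have "prob_space (gamma_law (a n) \<theta>)" using pos by (intro prob_space_gamma_law)
    ultimately show ?thesis
      using pos by (simp add: gamma_law_convolution[symmetric] char_sum_law C.prob_space_axioms)
  qed
  ultimately have "cmod (\<phi> n s - \<psi> n s) = cmod (char (gamma_law (c n) \<theta>) s) *
      cmod (char (?H (distr M borel (R (Suc n)))) s - char (?H (gamma_law (c (Suc n) + a (Suc n)) \<theta>)) s)"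
    by (simp add: norm_mult[symmetric] right_diff_distrib)
  also have "\<dots> \<le> 1 * (K * (a n / (a n + b n)) * \<bar>s\<bar>)"
  proof (intro mult_mono C.cmod_char_le_1 char_product_law_contraction K)
    show "prob_space (beta_law (a n) (b n))" using pos by (intro prob_space_beta_law)
    show "real_distribution (distr M borel (R (Suc n)))" by (rule real_distribution_R) simp
    show "real_distribution (gamma_law (c (Suc n) + a (Suc n)) \<theta>)"
      by (intro real_distribution_gamma_law add_pos_pos c_pos a_pos) auto
    show "(\<integral>\<^sup>+u. ennreal \<bar>u\<bar> \<partial>beta_law (a n) (b n)) = ennreal (a n / (a n + b n))"
      using nn_integral_beta_law_id[of "a n" "b n"] pos AE_beta_law_Ioo[of "a n" "b n"]
      by (subst nn_integral_cong_AE[of _ "\<lambda>u. ennreal u"]) (auto elim!: eventually_mono)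
  qed (use pos in auto)
  finally show ?thesis by simp
qed

lemma char_start:
  assumes n: "1 \<le> n"
  shows "cmod (\<phi> n s - \<psi> n s) \<le> (scaled_mean n / p n + (c n + a n) / \<theta>) * \<bar>s\<bar>"
proof -
  note pos = a_pos[OF n] c_pos[OF n] theta_pos
  have "cmod (\<phi> n s - \<psi> n s) \<le> cmod (\<phi> n s - 1) + cmod (\<psi> n s - 1)"
    by (rule norm_diff_triangle_ineq[of "\<phi> n s" 1 1 "\<psi> n s", simplified, THEN order_trans])
      (simp add: norm_minus_commute)
  also have "cmod (\<phi> n s - 1) \<le> scaled_mean n / p n * \<bar>s\<bar>"
    using n scaled_mean_nonneg[OF n] p_pos[OF n]
    by (intro cmod_char_minus_1_le real_distribution_R) (auto simp: nn_integral_distr nn_integral_R)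
  also have "cmod (\<psi> n s - 1) \<le> (c n + a n) / \<theta> * \<bar>s\<bar>"
  proof (intro cmod_char_minus_1_le real_distribution_gamma_law)
    show "(\<integral>\<^sup>+x. ennreal \<bar>x\<bar> \<partial>gamma_law (c n + a n) \<theta>) = ennreal ((c n + a n) / \<theta>)"
      using nn_integral_gamma_law_id[of "c n + a n" \<theta>] pos AE_gamma_law_pos[of "c n + a n" \<theta>]
      by (subst nn_integral_cong_AE[of _ "\<lambda>u. ennreal u"]) (auto elim!: eventually_mono)
  qed (use pos in auto)
  finally show ?thesis by (simp add: distrib_right)
qed

text \<open>The contraction factors accumulate to \<open>p (n + m) / p n\<close>.\<close>

lemma char_iterate:
  assumes n: "1 \<le> n" and K: "\<And>s. cmod (\<phi> (n + m) s - \<psi> (n + m) s) \<le> K * \<bar>s\<bar>"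
  shows "p n * cmod (\<phi> n s - \<psi> n s) \<le> p (n + m) * K * \<bar>s\<bar>"
  using K
proof (induction m arbitrary: K)
  case 0
  show ?case using mult_left_mono[OF 0[of s], of "p n"] p_pos[OF n] by (simp add: mult.assoc)
next
  case (Suc m)
  have "cmod (\<phi> (n + m) s - \<psi> (n + m) s) \<le> K * (a (n + m) / (a (n + m) + b (n + m))) * \<bar>s\<bar>" for s
    using n Suc.prems by (intro char_step) auto
  from Suc.IH[OF this] show ?case using n p_Suc[of "n + m"] by (simp add: mult_ac)
qed

text \<open>
  Iterating from a far index \<open>m\<close> back to \<open>n\<close> leaves an error that vanishes as \<open>m\<close> grows, so the two
  characteristic functions coincide.
\<close>

lemma law_R:
  assumes n: "1 \<le> n"
  shows "distr M borel (R n) = gamma_law (c n + a n) \<theta>"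
proof (rule Levy_uniqueness)
  show "\<phi> n = \<psi> n"
  proof
    fix s
    have "p n * cmod (\<phi> n s - \<psi> n s) \<le> 0"
    proof (rule tendsto_lowerbound)
      have "(\<lambda>m. (scaled_mean m + (p m * c m + p m * a m) / \<theta>) * \<bar>s\<bar>) \<longlonglongrightarrow> (0 + (0 + 0) / \<theta>) * \<bar>s\<bar>"
        using theta_pos
        by (intro tendsto_intros scaled_mean_tendsto pa_tendsto LIMSEQ_imp_Suc[OF summable_LIMSEQ_zero[OF summable_pc]]) auto
      then show "(\<lambda>m. (scaled_mean m + (p m * c m + p m * a m) / \<theta>) * \<bar>s\<bar>) \<longlonglongrightarrow> 0" by simp
      show "\<forall>\<^sub>F m in sequentially. p n * cmod (\<phi> n s - \<psi> n s) \<le> (scaled_mean m + (p m * c m + p m * a m) / \<theta>) * \<bar>s\<bar>"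
        using eventually_ge_at_top[of n]
      proof eventually_elim
        case (elim m)
        with n have "p n * cmod (\<phi> n s - \<psi> n s) \<le> p m * (scaled_mean m / p m + (c m + a m) / \<theta>) * \<bar>s\<bar>"
          using char_iterate[OF n, of "m - n" "scaled_mean m / p m + (c m + a m) / \<theta>" s] char_start[of m] by simp
        also have "p m * (scaled_mean m / p m + (c m + a m) / \<theta>) = scaled_mean m + (p m * c m + p m * a m) / \<theta>"
          using p_pos[of m] n elim by (simp add: algebra_simps add_divide_distrib)
        finally show ?case .
      qed
    qed simp
    then show "\<phi> n s = \<psi> n s"
      using p_pos[OF n] by (simp add: mult_le_0_iff)
  qed
qed (auto intro!: real_distribution_R real_distribution_gamma_law add_pos_pos n a_pos c_pos)

subsection \<open>Independence of the ratios\<close>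

lemma law_R_Y:
  assumes n: "1 \<le> n"
  shows "distr M (borel \<Otimes>\<^sub>M borel) (\<lambda>\<omega>. (R n \<omega>, Y n \<omega>)) =
    gamma_law (c n + a n) \<theta> \<Otimes>\<^sub>M beta_law (c n) (a n)"
proof -
  note pos = a_pos[OF n] b_pos[OF n] c_pos[OF n] theta_pos
  have H: "distr M borel (\<lambda>\<omega>. U n \<omega> * R (Suc n) \<omega>) = gamma_law (a n) \<theta>"
    using pos n by (simp add: law_UR law_R shapes[symmetric] beta_times_gamma)
  have "distr M (borel \<Otimes>\<^sub>M borel) (\<lambda>\<omega>. (R n \<omega>, Y n \<omega>)) = distr M (borel \<Otimes>\<^sub>M borel)
      (\<lambda>\<omega>. (G n \<omega> + U n \<omega> * R (Suc n) \<omega>, G n \<omega> / (G n \<omega> + U n \<omega> * R (Suc n) \<omega>)))"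
    using n R_rec[OF n] by (intro distr_cong_AE) (auto simp: Y_def elim!: eventually_mono)
  also have "\<dots> = distr (gamma_law (c n) \<theta> \<Otimes>\<^sub>M gamma_law (a n) \<theta>) (borel \<Otimes>\<^sub>M borel) (\<lambda>(g, h). (g + h, g / (g + h)))"
    unfolding H[symmetric] law_G_UR[OF n, symmetric] using n by (simp add: distr_distr comp_def)
  also have "\<dots> = gamma_law (c n + a n) \<theta> \<Otimes>\<^sub>M beta_law (c n) (a n)"
    using pos by (intro gamma_law_sum_ratio)
  finally show ?thesis .
qed

lemma prob_R_Y:
  assumes n: "1 \<le> n" and [measurable]: "A \<in> sets borel" "B \<in> sets borel"
  shows "prob ((R n -` A \<inter> space M) \<inter> (Y n -` B \<inter> space M)) =
    prob (R n -` A \<inter> space M) * measure (beta_law (c n) (a n)) B"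
proof -
  note pos = a_pos[OF n] c_pos[OF n] theta_pos
  interpret Be: prob_space "beta_law (c n) (a n)" using pos by (intro prob_space_beta_law)
  have "prob ((R n -` A \<inter> space M) \<inter> (Y n -` B \<inter> space M)) =
      measure (distr M (borel \<Otimes>\<^sub>M borel) (\<lambda>\<omega>. (R n \<omega>, Y n \<omega>))) (A \<times> B)"
    using n by (subst measure_distr) (auto intro!: arg_cong[where f = prob])
  also have "\<dots> = measure (gamma_law (c n + a n) \<theta>) A * measure (beta_law (c n) (a n)) B"
    unfolding law_R_Y[OF n] by (simp add: Be.emeasure_pair_measure_Times measure_def enn2real_mult)
  also have "measure (gamma_law (c n + a n) \<theta>) A = prob (R n -` A \<inter> space M)"
    unfolding law_R[OF n, symmetric] using n by (simp add: measure_distr)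
  finally show ?thesis .
qed

lemma prob_Y:
  assumes n: "1 \<le> n" and "B \<in> sets borel"
  shows "prob (Y n -` B \<inter> space M) = measure (beta_law (c n) (a n)) B"
  using prob_R_Y[OF n, of UNIV B] assms by (simp add: prob_space Int_absorb1)

lemma law_Y:
  assumes n: "1 \<le> n"
  shows "distr M borel (Y n) = beta_law (c n) (a n)"
proof (rule measure_eqI)
  interpret Be: prob_space "beta_law (c n) (a n)" using n by (intro prob_space_beta_law a_pos c_pos)
  fix B assume "B \<in> sets (distr M borel (Y n))"
  with n show "emeasure (distr M borel (Y n)) B = emeasure (beta_law (c n) (a n)) B"
    by (simp add: emeasure_distr emeasure_eq_measure Be.emeasure_eq_measure prob_Y)
qed simp

text \<open>
  The \<open>\<sigma>\<close>-algebra generated by the variables with index less than \<open>n\<close> together with \<open>Z n\<close>. It is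
  given by an intersection-stable generator, so that independence of it can be tested there.
\<close>

definition F :: "nat \<Rightarrow> 'w measure" where
  "F n = sigma (space M) {A \<inter> (Z n -` B \<inter> space M) | A B. A \<in> sets (past n) \<and> B \<in> sets borel}"

lemma space_F [simp]: "space (F n) = space M"
  by (auto simp: F_def intro!: space_measure_of)

lemma sets_F:
  "sets (F n) = sigma_sets (space M) {A \<inter> (Z n -` B \<inter> space M) | A B. A \<in> sets (past n) \<and> B \<in> sets borel}"
  by (auto simp: F_def intro!: sets_measure_of)

lemma past_F: "subalgebra (F n) (past n)"
proof -
  have "A \<in> sets (F n)" if "A \<in> sets (past n)" for A
  proof -
    have "A \<inter> (Z n -` UNIV \<inter> space M) \<in> sets (F n)"
      unfolding sets_F using that by (intro sigma_sets.Basic CollectI exI[of _ A] exI[of _ UNIV]) auto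
    moreover have "A \<subseteq> space M" using sets.sets_into_space[OF that] by simp
    ultimately show ?thesis by (simp add: Int_absorb2)
  qed
  then show ?thesis by (auto simp: subalgebra_def)
qed

text \<open>
  The recursion expresses every earlier tail, hence every earlier ratio, through \<open>Z n\<close> and the
  variables with index less than \<open>n\<close>.
\<close>

lemma Z_F:
  assumes "1 \<le> k" "k \<le> n"
  shows "Z k \<in> borel_measurable (F n)"
  using assms(2,1)
proof (induction k rule: inc_induct)
  case base
  have "Z n -` B \<inter> space M \<in> sets (F n)" if "B \<in> sets borel" for B
  proof -
    have "space M \<inter> (Z n -` B \<inter> space M) \<in> sets (F n)"
      unfolding sets_F using that sets.top[of "past n"] by (intro sigma_sets.Basic) auto
    then show ?thesis by (simp add: Int_absorb1)
  qed
  then show ?case by (auto simp: measurable_def)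
next
  case (step k)
  have [measurable]: "Z (Suc k) \<in> borel_measurable (F n)" using step by simp
  have [measurable]: "G k \<in> borel_measurable (F n)" "U k \<in> borel_measurable (F n)"
    using step by (auto intro!: measurable_from_subalg[OF past_F] G_sigma_gen U_sigma_gen)
  show ?case by (subst Z_rec[abs_def]) measurable
qed

lemma Y_F:
  assumes "1 \<le> k" "k < n"
  shows "Y k \<in> borel_measurable (F n)"
proof -
  have [measurable]: "Z k \<in> borel_measurable (F n)" using assms by (intro Z_F) auto
  have [measurable]: "G k \<in> borel_measurable (F n)"
    using assms by (auto intro!: measurable_from_subalg[OF past_F] G_sigma_gen)
  show ?thesis unfolding Y_def[abs_def] R_def by measurable
qed

text \<open>
  The pair \<open>(Z n, Y n)\<close> is a function of the variables with index at least \<open>n\<close>, so it is independent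
  of the past; and \<open>Y n\<close> is independent of \<open>Z n\<close> by the beta-gamma algebra.
\<close>

lemma Y_indep_F:
  assumes n: "1 \<le> n" and A: "A \<in> sets (F n)" and B: "B \<in> sets borel"
  shows "prob (A \<inter> (Y n -` B \<inter> space M)) = prob A * prob (Y n -` B \<inter> space M)"
proof -
  let ?A = "{A \<inter> (Z n -` B \<inter> space M) | A B. A \<in> sets (past n) \<and> B \<in> sets borel}"
  let ?B = "{Y n -` B \<inter> space M | B. B \<in> sets borel}"
  have past_ev: "sets (past n) \<subseteq> events"
  proof -
    have "{1..<n} <+> {1..<n} \<subseteq> {1..} <+> {1..}" by auto
    from subalgebra_sigma_gen[OF this] show ?thesis by (simp add: subalgebra_def)
  qed
  have "indep_set ?A ?B"
  proof (rule indep_setI)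
    show "?A \<subseteq> events" using past_ev n by auto
    show "?B \<subseteq> events" using n by auto
    fix x y assume "x \<in> ?A" "y \<in> ?B"
    then obtain A B C where x: "x = A \<inter> (Z n -` B \<inter> space M)" "A \<in> sets (past n)"
      and y: "y = Y n -` C \<inter> space M" and [measurable]: "B \<in> sets borel" "C \<in> sets borel" by auto
    have Z: "Z n -` B \<inter> space M \<in> sets (tail n)"
      using measurable_sets[OF Z_sigma_gen[OF order_refl], of B n] by simp
    have "Y n \<in> borel_measurable (tail n)"
      unfolding Y_def[abs_def] using n by (intro borel_measurable_divide G_sigma_gen R_sigma_gen) auto
    from measurable_sets[OF this, of C] have Yt: "y \<in> sets (tail n)" by (simp add: y)
    have ind: "prob (A \<inter> D) = prob A * prob D" if "D \<in> sets (tail n)" for D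
      by (rule indep_vars_sigma_gen[OF indep _ _ _ x(2) that]) (use n in auto)
    let ?B' = "ennreal -` B"
    have [measurable]: "?B' \<in> sets borel" using measurable_sets[of ennreal borel borel B] by simp
    have ae: "AE \<omega> in M. Z n \<omega> \<in> B \<longleftrightarrow> R n \<omega> \<in> ?B'"
      using AE_Z_finite[OF n] by eventually_elim (simp add: R_def)
    have "prob (Z n -` B \<inter> space M \<inter> y) = prob ((R n -` ?B' \<inter> space M) \<inter> y)"
      unfolding y using ae n by (intro finite_measure_eq_AE) (auto elim!: eventually_mono)
    also have "\<dots> = prob (R n -` ?B' \<inter> space M) * prob y"
      using n by (simp add: y prob_R_Y prob_Y)
    also have "prob (R n -` ?B' \<inter> space M) = prob (Z n -` B \<inter> space M)"
      using ae n by (intro finite_measure_eq_AE) (auto elim!: eventually_mono)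
    finally have "prob (Z n -` B \<inter> space M \<inter> y) = prob (Z n -` B \<inter> space M) * prob y" .
    then show "prob (x \<inter> y) = prob x * prob y"
      using ind[OF sets.Int[OF Z Yt]] ind[OF Z] by (simp add: x Int_assoc mult.assoc)
  qed
  then have "indep_set (sets (F n)) (sigma_sets (space M) ?B)"
    unfolding sets_F
  proof (rule indep_set_sigma_sets)
    show "Int_stable ?A"
    proof (rule Int_stableI)
      fix x y assume "x \<in> ?A" "y \<in> ?A"
      then obtain A B A' B' where "x = A \<inter> (Z n -` B \<inter> space M)" "y = A' \<inter> (Z n -` B' \<inter> space M)"
        "A \<in> sets (past n)" "A' \<in> sets (past n)" "B \<in> sets borel" "B' \<in> sets borel" by auto
      then have "x \<inter> y = (A \<inter> A') \<inter> (Z n -` (B \<inter> B') \<inter> space M)"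
        "A \<inter> A' \<in> sets (past n)" "B \<inter> B' \<in> sets borel" by auto
      then show "x \<inter> y \<in> ?A" by blast
    qed
    show "Int_stable ?B"
    proof (rule Int_stableI)
      fix x y assume "x \<in> ?B" "y \<in> ?B"
      then obtain B B' where "x = Y n -` B \<inter> space M" "y = Y n -` B' \<inter> space M"
        "B \<in> sets borel" "B' \<in> sets borel" by auto
      then have "x \<inter> y = Y n -` (B \<inter> B') \<inter> space M" "B \<inter> B' \<in> sets borel" by auto
      then show "x \<inter> y \<in> ?B" by blast
    qed
  qed
  then show ?thesis
    by (rule indep_setD) (use A B in auto)
qed

lemma indep_Y: "indep_vars (\<lambda>_. borel) Y {1..}"
  by (rule indep_varsI_past[where F = F]) (auto intro: Y_F Y_indep_F)

lemma AE_representation: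
  "AE \<omega> in M. summable (\<lambda>k. G (Suc k) \<omega> * (\<Prod>l = 1..<Suc k. U l \<omega>)) \<and>
    (\<forall>n\<ge>1. G n \<omega> * (\<Prod>l = 1..<n. U l \<omega>) / (\<Sum>k. G (Suc k) \<omega> * (\<Prod>l = 1..<Suc k. U l \<omega>)) =
      (\<Prod>l = 1..<n. 1 - Y l \<omega>) * Y n \<omega>)"
proof -
  have "AE \<omega> in M. \<forall>n\<ge>1. 0 < G n \<omega> \<and> 0 < U n \<omega> \<and> R n \<omega> = G n \<omega> + U n \<omega> * R (Suc n) \<omega>"
    unfolding AE_all_countable
  proof
    fix n
    show "AE \<omega> in M. n \<ge> 1 \<longrightarrow> 0 < G n \<omega> \<and> 0 < U n \<omega> \<and> R n \<omega> = G n \<omega> + U n \<omega> * R (Suc n) \<omega>"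
    proof (cases "1 \<le> n")
      case True
      from AE_G_pos[OF True] AE_U_Ioo[OF True] R_rec[OF True] show ?thesis
        by eventually_elim auto
    qed simp
  qed
  with AE_Z_finite[OF order_refl] show ?thesis
  proof eventually_elim
    case (elim \<omega>)
    let ?P = "\<lambda>n. \<Prod>l = 1..<n. U l \<omega>"
    let ?f = "\<lambda>k. G (Suc k) \<omega> * ?P (Suc k)"
    have G_pos: "0 < G n \<omega>" and U_pos: "0 < U n \<omega>"
      and rec: "R n \<omega> = G n \<omega> + U n \<omega> * R (Suc n) \<omega>" if "1 \<le> n" for n
      using elim(2) that by blast+
    have P_pos: "0 < ?P n" for n using U_pos by (intro prod_pos) auto
    have f_nonneg: "0 \<le> ?f k" for k
      using G_pos P_pos[of "Suc k"] by (intro mult_nonneg_nonneg less_imp_le) auto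
    have "(\<Prod>l = 1..<Suc k. ennreal (U l \<omega>)) = ennreal (?P (Suc k))" for k
      using U_pos by (intro prod_ennreal) (auto intro: less_imp_le)
    then have Z1: "Z 1 \<omega> = (\<Sum>k. ennreal (?f k))"
      using G_pos P_pos by (simp add: Z_def ennreal_mult less_imp_le del: prod.op_ivl_Suc)
    with elim(1) have sm: "summable ?f"
      using f_nonneg by (intro summable_suminf_not_top) auto
    with Z1 f_nonneg have S: "R 1 \<omega> = (\<Sum>k. ?f k)"
      by (simp add: R_def suminf_ennreal2 suminf_nonneg)
    have R_pos: "0 < R n \<omega>" if "1 \<le> n" for n
    proof -
      have "0 \<le> R (Suc n) \<omega>" by (simp add: R_def)
      then show ?thesis
        unfolding rec[OF that] using G_pos[OF that] U_pos[OF that] by (intro add_pos_nonneg) auto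
    qed
    \<comment> \<open>telescoping: \<open>1 - Y l = U l * R (l + 1) / R l\<close>\<close>
    have prod_eq: "(\<Prod>l = 1..<n. 1 - Y l \<omega>) * R 1 \<omega> = ?P n * R n \<omega>" if "1 \<le> n" for n
      using that
    proof (induction n rule: dec_induct)
      case (step n)
      have "R n \<omega> \<noteq> 0" using R_pos[of n] step by simp
      then have "(1 - Y n \<omega>) * R n \<omega> = R n \<omega> - G n \<omega>"
        by (simp add: Y_def field_simps)
      also have "\<dots> = U n \<omega> * R (Suc n) \<omega>" using rec[of n] step by linarith
      finally have *: "(1 - Y n \<omega>) * R n \<omega> = U n \<omega> * R (Suc n) \<omega>" .
      have "(\<Prod>l = 1..<Suc n. 1 - Y l \<omega>) * R 1 \<omega> = (1 - Y n \<omega>) * (?P n * R n \<omega>)"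
        using step by (simp add: prod.atLeastLessThan_Suc mult_ac)
      also have "\<dots> = ?P n * (U n \<omega> * R (Suc n) \<omega>)"
        by (simp add: mult.left_commute flip: *)
      finally show ?case using step by (simp add: prod.atLeastLessThan_Suc mult_ac)
    qed simp
    have "G n \<omega> * ?P n / R 1 \<omega> = (\<Prod>l = 1..<n. 1 - Y l \<omega>) * Y n \<omega>" if "1 \<le> n" for n
    proof -
      have "G n \<omega> * ?P n = Y n \<omega> * (?P n * R n \<omega>)"
        using R_pos[OF that] by (simp add: Y_def)
      then show ?thesis
        using R_pos[of 1] prod_eq[OF that] by (simp add: field_simps)
    qed
    with sm show ?case unfolding S by blast
  qed
qed

end

section \<open>The stick-breaking representation\<close>

theorem theorem5p2:
  fixes M :: "'w measure"
    and \<theta> :: real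
    and a b c p :: "nat \<Rightarrow> real"
    and G U P V :: "nat \<Rightarrow> 'w \<Rightarrow> real"
  assumes "prob_space M"
    and "0 < \<theta>"
    and "\<And>n. 1 \<le> n \<Longrightarrow> 0 < a n"
    and "\<And>n. 1 \<le> n \<Longrightarrow> 0 < b n"
    and "\<And>j. 1 \<le> j \<Longrightarrow> p j = (\<Prod>l = 1..<j. a l / (a l + b l))"
    and "\<And>j. 1 \<le> j \<Longrightarrow> 0 < a j + b j - a (j + 1)"
    and "summable (\<lambda>k. p (k + 2) * (a (k + 1) + b (k + 1) - a (k + 2)))"
    and "(\<lambda>j. p j * a j) \<longlonglongrightarrow> 0"
    and "0 < c 1"
    and "\<And>j. 2 \<le> j \<Longrightarrow> c j = a (j - 1) + b (j - 1) - a j"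
    and "\<And>n. 1 \<le> n \<Longrightarrow> distributed M lborel (G n) (gamma_density (c n) \<theta>)"
    and "\<And>n. 1 \<le> n \<Longrightarrow> distributed M lborel (U n) (beta_density (a n) (b n))"
    and "prob_space.indep_vars M (\<lambda>_. borel) (case_sum G U) ({1..} <+> {1..})"
    and "\<And>j \<omega>. 1 \<le> j \<Longrightarrow> P j \<omega> = (\<Prod>l = 1..<j. U l \<omega>)"
    and "\<And>n \<omega>. 1 \<le> n \<Longrightarrow> V n \<omega> = G n \<omega> * P n \<omega> / (\<Sum>k. G (Suc k) \<omega> * P (Suc k) \<omega>)"
  shows "(AE \<omega> in M. summable (\<lambda>k. G (Suc k) \<omega> * P (Suc k) \<omega>)) \<and>
    (\<exists>Y :: nat \<Rightarrow> 'w \<Rightarrow> real.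
       prob_space.indep_vars M (\<lambda>_. borel) Y {1..} \<and>
       (\<forall>n\<ge>1. distributed M lborel (Y n) (beta_density (c n) (a n))) \<and>
       (AE \<omega> in M. \<forall>n\<ge>1. V n \<omega> = (\<Prod>l = 1..<n. 1 - Y l \<omega>) * Y n \<omega>))"
proof -
  have c_Suc: "c (Suc n) = a n + b n - a (Suc n)" if "1 \<le> n" for n
    using assms(10)[of "Suc n"] that by simp
  have c_pos: "0 < c n" if "1 \<le> n" for n
  proof (cases n)
    case (Suc m)
    with assms(6)[of m] assms(9) c_Suc[of m] show ?thesis by (cases m) auto
  qed (use that in simp)
  interpret prob_space M by fact
  interpret gamma_beta_series M \<theta> a b c p G U
  proof unfold_locales
    \<comment> \<open>the assumed series starts at index 2; a first term does not affect summability\<close>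
    show "summable (\<lambda>n. p (Suc n) * c (Suc n))"
    proof (subst summable_Suc_iff[symmetric], rule summable_cong[THEN iffD1, OF _ assms(7)])
      show "\<forall>\<^sub>F k in sequentially. p (k + 2) * (a (k + 1) + b (k + 1) - a (k + 2)) =
          p (Suc (Suc k)) * c (Suc (Suc k))"
        using c_Suc by (simp add: numeral_2_eq_2)
    qed
    show "distr M borel (G n) = gamma_law (c n) \<theta>" if "1 \<le> n" for n
      using distributed_distr_eq_density[OF assms(11)[OF that]]
      by (simp add: gamma_law_def cong: distr_cong)
    show "distr M borel (U n) = beta_law (a n) (b n)" if "1 \<le> n" for n
      using distributed_distr_eq_density[OF assms(12)[OF that]]
      by (simp add: beta_law_def cong: distr_cong)
  qed (use assms c_pos c_Suc in auto)
  have rep: "AE \<omega> in M. summable (\<lambda>k. G (Suc k) \<omega> * P (Suc k) \<omega>) \<and>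
      (\<forall>n\<ge>1. V n \<omega> = (\<Prod>l = 1..<n. 1 - Y l \<omega>) * Y n \<omega>)"
    using AE_representation by eventually_elim (simp add: assms(14,15))
  have "distributed M lborel (Y n) (beta_density (c n) (a n))" if "1 \<le> n" for n
    unfolding distributed_def
    using law_Y[OF that] measurable_Y[OF that] by (simp add: beta_law_def cong: distr_cong)
  with rep indep_Y show ?thesis
    by (intro conjI exI[of _ Y]) (auto elim!: eventually_mono)
qed

end
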